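(* Let $S$ be an affine semigroup minimally generated by $\mathcal{A}=\{\mathbf{a}_1,\ldots,\mathbf{a}_p\}\subset\mathbb{N}^r$ ($p$ distinct elements). If $\mathrm{Betti}(S)=\{\mathbf{d}\}$, then $$\mathsf{c}(S)=\omega(S)=\mathsf{t}(S)=\max(\mathsf{L}(\mathbf{d})).$$
   Context: $\mathbb{N}$ denotes the nonnegative integers. An affine semigroup is a finitely generated submonoid of $\mathbb{N}^r$ for some positive integer $r$. $S$ is minimally generated by $\mathcal{A}$ if $S=\mathbb{N}\mathbf{a}_1+\cdots+\mathbb{N}\mathbf{a}_p$ and no proper subset of $\mathcal{A}$ generates $S$; the $\mathbf{a}_i$ are the minimal generators. The factorization homomorphism is $\pi_\mathcal{A}:\mathbb{N}^p\to S$, $\mathbf{u}=(u_1,\ldots,u_p)\mapsto\sum_{i=1}^p u_i\mathbf{a}_i$; for $\mathbf{a}\in S$, $\mathsf{Z}(\mathbf{a})=\pi_\mathcal{A}^{-1}(\mathbf{a})$ is its set of factorizations. The kernel congruence $\equiv_\mathcal{A}$ is the set of pairs $(\mathbf{u},\mathbf{v})\in\mathbb{N}^p\times\mathbb{N}^p$ with $\pi_\mathcal{A}(\mathbf{u})=\pi_\mathcal{A}(\mathbf{v})$. A presentation of $S$ is a set $\sigma\subseteq\mathbb{N}^p\times\mathbb{N}^p$ such that $\equiv_\mathcal{A}$ is the least congruence on $\mathbb{N}^p$ containing $\sigma$; it is minimal if no proper subset of it generates $\equiv_\mathcal{A}$ as a congruence. $\mathrm{Betti}(S)=\{\pi_\mathcal{A}(\mathbf{u})\mid(\mathbf{u},\mathbf{v})\in\sigma\}$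 for a minimal presentation $\sigma$ of $S$; this set is known not to depend on the choice of $\sigma$. For $\mathbf{u}=(u_1,\ldots,u_p)\in\mathbb{N}^p$, $|\mathbf{u}|=u_1+\cdots+u_p$ and $\mathrm{supp}(\mathbf{u})=\{i\mid u_i\ne 0\}$. The set of lengths of $\mathbf{a}\in S$ is $\mathsf{L}(\mathbf{a})=\{|\mathbf{u}| : \mathbf{u}\in\mathsf{Z}(\mathbf{a})\}$. For $\mathbf{u},\mathbf{v}\in\mathbb{N}^p$, $\mathbf{u}\wedge\mathbf{v}=(\min(u_1,v_1),\ldots,\min(u_p,v_p))$ and $\mathsf{d}(\mathbf{u},\mathbf{v})=\max\{|\mathbf{u}-\mathbf{u}\wedge\mathbf{v}|,|\mathbf{v}-\mathbf{u}\wedge\mathbf{v}|\}$. The catenary degree $\mathsf{c}(S)$ is the minimum $N\in\mathbb{N}$ such that for any $\mathbf{a}\in S$ and any $\mathbf{u},\mathbf{v}\in\mathsf{Z}(\mathbf{a})$ there exists a sequence $\mathbf{u}_0,\ldots,\mathbf{u}_k\in\mathsf{Z}(\mathbf{a})$ with $\mathbf{u}_0=\mathbf{u}$, $\mathbf{u}_k=\mathbf{v}$ and $\mathsf{d}(\mathbf{u}_{i-1},\mathbf{u}_i)\le N$ for all $i\in\{1,\ldots,k\}$. The $\omega$-primality $\omega(S)$ is the minimum of all $N\in\mathbb{N}\cup\{\infty\}$ such that for every minimal generator $\mathbf{a}_j$, whenever $\sum_{i\in I}\mathbf{b}_i-\mathbf{a}_j\in S$ with $I$ a finite index set and $\mathbf{b}_i\in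 S$ for all $i\in I$, there exists $\Omega\subseteq I$ with $\#\Omega\le N$ such that $\sum_{i\in\Omega}\mathbf{b}_i-\mathbf{a}_j\in S$. The tame degree $\mathsf{t}(S)$ is the minimum of all $N\in\mathbb{N}\cup\{\infty\}$ such that for all $\mathbf{a}\in S$, all $\mathbf{u}\in\mathsf{Z}(\mathbf{a})$ and every minimal generator $\mathbf{a}_i$ with $\mathbf{a}-\mathbf{a}_i\in S$, there exists $\mathbf{u}'\in\mathsf{Z}(\mathbf{a})$ such that $i\in\mathrm{supp}(\mathbf{u}')$ and $\mathsf{d}(\mathbf{u},\mathbf{u}')\le N$. *)

theory Defs
  imports "HOL-Analysis.Finite_Cartesian_Product" "HOL-Library.Extended_Nat"
begin

text \<open>The set \<open>\<nat>a\<^sub>1 + \<dots> + \<nat>a\<^sub>n\<close> for a finite \<open>A = {a\<^sub>1, \<dots>, a\<^sub>n}\<close>; not meaningful for infinite \<open>A\<close>.\<close>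

definition nat_span :: "(nat ^ 'r) set \<Rightarrow> (nat ^ 'r) set" where
  "nat_span A = {\<Sum>x\<in>A. c x *s x | c :: nat ^ 'r \<Rightarrow> nat. True}"

definition affine_semigroup :: "(nat ^ 'r) set \<Rightarrow> bool" where
  "affine_semigroup S \<longleftrightarrow> (\<exists>A. finite A \<and> S = nat_span A)"

definition minimally_generated_by :: "(nat ^ 'r) set \<Rightarrow> (nat ^ 'r) set \<Rightarrow> bool" where
  "minimally_generated_by S A \<longleftrightarrow>
     finite A \<and> S = nat_span A \<and> (\<forall>B. B \<subset> A \<longrightarrow> nat_span B \<noteq> S)"

text \<open>\<open>x - y \<in> S\<close>, with the difference taken in \<open>\<int>\<^sup>r\<close>: subtraction on \<^typ>\<open>nat\<close> truncates.\<close>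

definition diff_mem :: "nat ^ 'r \<Rightarrow> nat ^ 'r \<Rightarrow> (nat ^ 'r) set \<Rightarrow> bool" where
  "diff_mem x y S \<longleftrightarrow> (\<exists>s\<in>S. x = y + s)"

text \<open>
  A generating tuple \<open>(a\<^sub>1, \<dots>, a\<^sub>p)\<close> is a function \<open>a\<close> on a finite index type \<open>'p\<close>.
\<close>

definition fact_hom :: "('p::finite \<Rightarrow> nat ^ 'r) \<Rightarrow> nat ^ 'p \<Rightarrow> nat ^ 'r" where
  "fact_hom a u = (\<Sum>i\<in>UNIV. (u $ i) *s a i)"

definition factorizations :: "('p::finite \<Rightarrow> nat ^ 'r) \<Rightarrow> nat ^ 'r \<Rightarrow> (nat ^ 'p) set" where
  "factorizations a x = {u. fact_hom a u = x}"

definition kernel_congruence :: "('p::finite \<Rightarrow> nat ^ 'r) \<Rightarrow> (nat ^ 'p) rel" where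
  "kernel_congruence a = {(u, v). fact_hom a u = fact_hom a v}"

definition monoid_congruence :: "(nat ^ 'p) rel \<Rightarrow> bool" where
  "monoid_congruence R \<longleftrightarrow>
     equiv UNIV R \<and> (\<forall>u v w. (u, v) \<in> R \<longrightarrow> (u + w, v + w) \<in> R)"

definition generated_congruence :: "(nat ^ 'p) rel \<Rightarrow> (nat ^ 'p) rel" where
  "generated_congruence \<sigma> = \<Inter>{R. monoid_congruence R \<and> \<sigma> \<subseteq> R}"

definition presentation :: "('p::finite \<Rightarrow> nat ^ 'r) \<Rightarrow> (nat ^ 'p) rel \<Rightarrow> bool" where
  "presentation a \<sigma> \<longleftrightarrow> generated_congruence \<sigma> = kernel_congruence a"

definition minimal_presentation :: "('p::finite \<Rightarrow> nat ^ 'r) \<Rightarrow> (nat ^ 'p) rel \<Rightarrow> bool" where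
  "minimal_presentation a \<sigma> \<longleftrightarrow>
     presentation a \<sigma> \<and> (\<forall>\<tau>. \<tau> \<subset> \<sigma> \<longrightarrow> \<not> presentation a \<tau>)"

text \<open>
  Minimal presentations exist (Redei's theorem gives a finite presentation), and the set
  below does not depend on the one that is chosen.
\<close>

definition Betti :: "('p::finite \<Rightarrow> nat ^ 'r) \<Rightarrow> (nat ^ 'r) set" where
  "Betti a = (let \<sigma> = (SOME \<sigma>. minimal_presentation a \<sigma>)
              in {fact_hom a u | u v. (u, v) \<in> \<sigma>})"

definition len :: "nat ^ 'p::finite \<Rightarrow> nat" where
  "len u = (\<Sum>i\<in>UNIV. u $ i)"

definition supp :: "nat ^ 'p \<Rightarrow> 'p set" where
  "supp u = {i. u $ i \<noteq> 0}"

definition lengths :: "('p::finite \<Rightarrow> nat ^ 'r) \<Rightarrow> nat ^ 'r \<Rightarrow> nat set" where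
  "lengths a x = len ` factorizations a x"

definition meet :: "nat ^ 'p \<Rightarrow> nat ^ 'p \<Rightarrow> nat ^ 'p" where
  "meet u v = (\<chi> i. min (u $ i) (v $ i))"

text \<open>The truncated differences are exact here, since \<open>meet u v\<close> is below \<open>u\<close> and \<open>v\<close>.\<close>

definition fdist :: "nat ^ 'p::finite \<Rightarrow> nat ^ 'p \<Rightarrow> nat" where
  "fdist u v = max (len (u - meet u v)) (len (v - meet u v))"

definition catenary_degree :: "(nat ^ 'r) set \<Rightarrow> ('p::finite \<Rightarrow> nat ^ 'r) \<Rightarrow> nat" where
  "catenary_degree S a = (LEAST N.
     \<forall>x\<in>S. \<forall>u\<in>factorizations a x. \<forall>v\<in>factorizations a x.
       \<exists>(k::nat) w. w 0 = u \<and> w k = v \<and> (\<forall>i\<le>k. w i \<in> factorizations a x) \<and>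
         (\<forall>i\<in>{1..k}. fdist (w (i - 1)) (w i) \<le> N))"

text \<open>Finite index sets are taken inside \<^typ>\<open>nat\<close>, which loses no generality.\<close>

definition omega_primality :: "(nat ^ 'r) set \<Rightarrow> ('p::finite \<Rightarrow> nat ^ 'r) \<Rightarrow> enat" where
  "omega_primality S a = (LEAST N.
     \<forall>j. \<forall>(I :: nat set) b. finite I \<longrightarrow> (\<forall>i\<in>I. b i \<in> S) \<longrightarrow> diff_mem (\<Sum>i\<in>I. b i) (a j) S \<longrightarrow>
       (\<exists>\<Omega>\<subseteq>I. enat (card \<Omega>) \<le> N \<and> diff_mem (\<Sum>i\<in>\<Omega>. b i) (a j) S))"

definition tame_degree :: "(nat ^ 'r) set \<Rightarrow> ('p::finite \<Rightarrow> nat ^ 'r) \<Rightarrow> enat" where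
  "tame_degree S a = (LEAST N.
     \<forall>x\<in>S. \<forall>u\<in>factorizations a x. \<forall>i. diff_mem x (a i) S \<longrightarrow>
       (\<exists>u'\<in>factorizations a x. i \<in> supp u' \<and> enat (fdist u u') \<le> N))"

end

theory Submission
  imports Defs
begin

text \<open>
  If \<open>d\<close> is the only Betti element, any two factorizations of an element are connected by
  \<^emph>\<open>swaps\<close> \<open>w + z \<mapsto> w + z'\<close> with \<open>z\<close>, \<open>z'\<close> factorizations of \<open>d\<close>.
  Two distinct factorizations of \<open>d\<close> have disjoint supports: otherwise, cancelling a common
  generator gives two distinct factorizations of an element strictly below \<open>d\<close>, to which no swap
  applies. So a swap between different factorizations of \<open>d\<close> costs the larger of the two lengths,
  and a factorization that has to acquire a new generator can do so by a single swap; all three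
  invariants therefore equal the maximal length of a factorization of \<open>d\<close>.
\<close>

section \<open>Dickson's lemma\<close>

text \<open>Every sequence has a monotone subsequence; a decreasing one in the naturals attains its
  minimum and is constant from there on, so its tail is increasing as well.\<close>

lemma nat_seq_incseq_subseq:
  fixes s :: "nat \<Rightarrow> nat"
  shows "\<exists>f. strict_mono f \<and> incseq (s \<circ> f)"
proof -
  obtain f where f: "strict_mono f" "monoseq (\<lambda>n. s (f n))"
    using seq_monosub by blast
  show ?thesis
  proof (cases "incseq (s \<circ> f)")
    case True
    then show ?thesis using f by blast
  next
    case False
    then have dec: "decseq (\<lambda>n. s (f n))"
      using f(2) by (auto simp: monoseq_iff comp_def)
    obtain N where N: "\<And>n. s (f N) \<le> s (f n)"
      using ex_has_least_nat[of "\<lambda>_. True" undefined "\<lambda>n. s (f n)"] by auto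
    have const: "s (f (N + n)) = s (f N)" for n
      using N decseqD[OF dec, of N "N + n"] by (simp add: le_antisym)
    have "strict_mono (\<lambda>n. f (N + n))"
      using f(1) by (auto simp: strict_mono_def)
    moreover have "incseq (s \<circ> (\<lambda>n. f (N + n)))"
      by (simp add: incseq_def const)
    ultimately show ?thesis by blast
  qed
qed

text \<open>Coordinates are treated one at a time: refining the subsequence for a new coordinate
  keeps the earlier ones increasing.\<close>

lemma dickson_subseq:
  fixes s :: "nat \<Rightarrow> 'k \<Rightarrow> nat"
  assumes "finite K"
  shows "\<exists>f. strict_mono f \<and> (\<forall>k\<in>K. incseq (\<lambda>n. s (f n) k))"
  using assms
proof (induction K)
  case empty
  show ?case using strict_mono_id by blast
next
  case (insert k K)
  then obtain f where f: "strict_mono f" "\<forall>k\<in>K. incseq (\<lambda>n. s (f n) k)"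
    by blast
  obtain g where g: "strict_mono g" "incseq ((\<lambda>n. s (f n) k) \<circ> g)"
    using nat_seq_incseq_subseq by blast
  have "strict_mono (f \<circ> g)"
    using f g by (simp add: strict_mono_o)
  moreover have "incseq (\<lambda>n. s ((f \<circ> g) n) k')" if "k' \<in> insert k K" for k'
  proof (cases "k' = k")
    case True
    then show ?thesis using g(2) by (simp add: comp_def)
  next
    case False
    then have "incseq (\<lambda>n. s (f n) k')" using that f by blast
    then show ?thesis
      using strict_mono_mono[OF g(1)] by (auto simp: incseq_def mono_def)
  qed
  ultimately show ?case by blast
qed

text \<open>An infinite set would contain an injective sequence, and Dickson's lemma finds two
  comparable terms in it. A pair is read as one vector over the sum type \<open>'n + 'n\<close>, so
  that both components are handled at once.\<close>

lemma finite_antichain_vec_pair: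
  fixes M :: "((nat ^ 'n::finite) \<times> (nat ^ 'n)) set"
  assumes anti: "\<And>u v u' v'. (u, v) \<in> M \<Longrightarrow> (u', v') \<in> M \<Longrightarrow>
      \<forall>i. u $ i \<le> u' $ i \<Longrightarrow> \<forall>i. v $ i \<le> v' $ i \<Longrightarrow> (u, v) = (u', v')"
  shows "finite M"
proof (rule ccontr)
  assume "infinite M"
  then obtain s :: "nat \<Rightarrow> (nat ^ 'n) \<times> (nat ^ 'n)" where s: "inj s" "range s \<subseteq> M"
    using infinite_countable_subset by blast
  define t where "t n k = (case k of Inl i \<Rightarrow> fst (s n) $ i | Inr i \<Rightarrow> snd (s n) $ i)"
    for n and k :: "'n + 'n"
  obtain f where f: "strict_mono f" "\<forall>k\<in>UNIV. incseq (\<lambda>n. t (f n) k)"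
    using dickson_subseq[of UNIV t] by auto
  have "t (f 0) k \<le> t (f 1) k" for k
    using f(2) by (simp add: incseq_def)
  from this[of "Inl _"] this[of "Inr _"]
  have "\<forall>i. fst (s (f 0)) $ i \<le> fst (s (f 1)) $ i" "\<forall>i. snd (s (f 0)) $ i \<le> snd (s (f 1)) $ i"
    by (auto simp: t_def)
  moreover have "(fst (s n), snd (s n)) \<in> M" for n
    using s(2) by auto
  ultimately have "s (f 0) = s (f 1)"
    using anti by (metis prod.collapse)
  then have "f 0 = f 1"
    using s(1) by (simp add: inj_eq)
  then show False
    using f(1) by (auto dest: strict_monoD[of f 0 1])
qed

section \<open>Factorizations\<close>

lemma fact_hom_0 [simp]: "fact_hom a 0 = 0"
  by (simp add: fact_hom_def vec_eq_iff)

lemma fact_hom_add: "fact_hom a (u + v) = fact_hom a u + fact_hom a v"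
  by (simp add: fact_hom_def vec_eq_iff sum.distrib algebra_simps)

lemma fact_hom_sum: "fact_hom a (\<Sum>i\<in>I. u i) = (\<Sum>i\<in>I. fact_hom a (u i))"
  by (induction I rule: infinite_finite_induct) (auto simp: fact_hom_add)

lemma fact_hom_axis [simp]: "fact_hom a (axis i (Suc 0)) = a i"
  by (simp add: fact_hom_def vec_eq_iff axis_def if_distrib[of "\<lambda>x. x * _"] cong: if_cong)

lemma len_0 [simp]: "len 0 = 0"
  by (simp add: len_def)

lemma len_add: "len (u + v) = len u + len v"
  by (simp add: len_def sum.distrib)

lemma len_eq_0 [simp]: "len u = 0 \<longleftrightarrow> u = 0"
  by (simp add: len_def vec_eq_iff)

text \<open>Replaces the order by a sum, so that later arguments can use additivity of
  \<open>fact_hom\<close> instead of truncated subtraction.\<close>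

lemma vec_nat_le_ex_add:
  fixes u v :: "nat ^ 'n"
  assumes "\<And>i. u $ i \<le> v $ i"
  obtains w where "v = u + w"
proof
  show "v = u + (v - u)"
    using assms by (simp add: vec_eq_iff)
qed

lemma vec_nat_split_axis:
  fixes u :: "nat ^ 'n"
  assumes "u $ i \<noteq> 0"
  obtains w where "u = axis i 1 + w"
proof -
  have le: "axis i 1 $ k \<le> u $ k" for k
    using assms by (auto simp: axis_def)
  obtain w where "u = axis i 1 + w" using le by (rule vec_nat_le_ex_add)
  then show thesis by (rule that)
qed

section \<open>Distance between factorizations\<close>

text \<open>A common summand passes into the meet and cancels; hence exchanging \<open>u\<close> for
  \<open>v\<close> inside a larger vector costs no more than \<open>fdist u v\<close>.\<close>

lemma fdist_add_left: "fdist (w + u) (w + v) = fdist u v"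
proof -
  have "meet (w + u) (w + v) = w + meet u v"
    by (simp add: meet_def vec_eq_iff min_add_distrib_right)
  then show ?thesis
    by (simp add: fdist_def)
qed

lemma fdist_self [simp]: "fdist u u = 0"
proof -
  have "meet u u = u" by (simp add: meet_def vec_eq_iff)
  then show ?thesis by (simp add: fdist_def)
qed

lemma fdist_le: "fdist u v \<le> max (len u) (len v)"
proof -
  have "len (u - w) \<le> len u" for u w :: "nat ^ 'a"
    unfolding len_def by (rule sum_mono) simp
  from this[of u "meet u v"] this[of v "meet u v"] show ?thesis
    unfolding fdist_def by linarith
qed

lemma fdist_disjoint:
  assumes "\<And>i. u $ i = 0 \<or> v $ i = 0"
  shows "fdist u v = max (len u) (len v)"
proof -
  have "min (u $ i) (v $ i) = 0" for i
    using assms[of i] by auto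
  then have "meet u v = 0"
    by (simp add: meet_def vec_eq_iff)
  then show ?thesis
    by (simp add: fdist_def)
qed

section \<open>The semigroup as the image of the factorization homomorphism\<close>

lemma nat_span_range:
  fixes a :: "'p::finite \<Rightarrow> nat ^ 'r"
  assumes "inj a"
  shows "nat_span (range a) = range (fact_hom a)"
proof (intro equalityI subsetI)
  fix x assume "x \<in> nat_span (range a)"
  then obtain c where "x = (\<Sum>y\<in>range a. c y *s y)"
    unfolding nat_span_def by blast
  then have "x = fact_hom a (\<chi> i. c (a i))"
    using assms by (simp add: fact_hom_def sum.reindex)
  then show "x \<in> range (fact_hom a)" by blast
next
  fix x assume "x \<in> range (fact_hom a)"
  then obtain u where "x = fact_hom a u" by blast
  then have "x = (\<Sum>y\<in>range a. (u $ (inv a y)) *s y)"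
    using assms by (simp add: fact_hom_def sum.reindex)
  then show "x \<in> nat_span (range a)"
    unfolding nat_span_def by (intro CollectI exI[of _ "\<lambda>y. u $ inv a y"]) simp
qed

text \<open>A zero generator contributes nothing to any combination, so the remaining ones would
  still generate.\<close>

lemma minimal_generator_nonzero:
  assumes "minimally_generated_by S A" "x \<in> A"
  shows "x \<noteq> 0"
proof
  assume "x = 0"
  have fin: "finite A" and S: "S = nat_span A"
    using assms(1) by (auto simp: minimally_generated_by_def)
  have "(\<Sum>y\<in>A. c y *s y) = (\<Sum>y\<in>A - {x}. c y *s y)" for c :: "nat ^ 'a \<Rightarrow> nat"
  proof -
    have "c x *s x = 0" using \<open>x = 0\<close> by (simp add: vec_eq_iff)
    then show ?thesis using fin assms(2) by (simp add: sum.remove)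
  qed
  then have "nat_span (A - {x}) = S"
    unfolding S nat_span_def by simp
  moreover have "A - {x} \<subset> A"
    using assms(2) by blast
  ultimately show False
    using assms(1) by (auto simp: minimally_generated_by_def)
qed

text \<open>Turns divisibility by a generator into a statement on supports, the form in which both
  the tame degree and the omega-primality are computed.\<close>

lemma diff_mem_iff:
  "diff_mem x (a i) (range (fact_hom a)) \<longleftrightarrow> (\<exists>v. fact_hom a v = x \<and> v $ i \<noteq> 0)"
proof
  assume "diff_mem x (a i) (range (fact_hom a))"
  then obtain u where "x = a i + fact_hom a u"
    unfolding diff_mem_def by blast
  then have "fact_hom a (axis i 1 + u) = x"
    by (simp add: fact_hom_add)
  moreover have "(axis i 1 + u) $ i \<noteq> 0"
    by (simp add: axis_def)
  ultimately show "\<exists>v. fact_hom a v = x \<and> v $ i \<noteq> 0" by blast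
next
  assume "\<exists>v. fact_hom a v = x \<and> v $ i \<noteq> 0"
  then obtain v w where "fact_hom a v = x" "v = axis i 1 + w"
    using vec_nat_split_axis by metis
  then have "x = a i + fact_hom a w"
    by (auto simp: fact_hom_add)
  then show "diff_mem x (a i) (range (fact_hom a))"
    unfolding diff_mem_def by blast
qed

section \<open>Existence of minimal presentations\<close>

lemma monoid_congruence_kernel: "monoid_congruence (kernel_congruence a)"
  by (auto simp: monoid_congruence_def kernel_congruence_def equiv_def refl_on_def sym_def
      trans_def fact_hom_add)

lemma monoid_congruence_generated: "monoid_congruence (generated_congruence \<sigma>)"
proof -
  have "refl (generated_congruence \<sigma>)"
    by (auto simp: generated_congruence_def monoid_congruence_def equiv_def refl_on_def)
  moreover have "sym (generated_congruence \<sigma>)"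
    by (auto simp: generated_congruence_def monoid_congruence_def equiv_def sym_def)
  moreover have "trans (generated_congruence \<sigma>)"
  proof (rule transI)
    fix u v w
    assume uv: "(u, v) \<in> generated_congruence \<sigma>" and vw: "(v, w) \<in> generated_congruence \<sigma>"
    have "(u, w) \<in> R" if R: "monoid_congruence R" "\<sigma> \<subseteq> R" for R
    proof -
      have "(u, v) \<in> R" "(v, w) \<in> R"
        using uv vw R by (auto simp: generated_congruence_def)
      moreover have "trans R"
        using R by (simp add: monoid_congruence_def equiv_def)
      ultimately show ?thesis by (rule transD[rotated])
    qed
    then show "(u, w) \<in> generated_congruence \<sigma>"
      by (simp add: generated_congruence_def)
  qed
  moreover have "(u + w, v + w) \<in> generated_congruence \<sigma>"
    if "(u, v) \<in> generated_congruence \<sigma>" for u v w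
    using that by (auto simp: generated_congruence_def monoid_congruence_def)
  ultimately show ?thesis
    by (simp add: monoid_congruence_def equiv_def)
qed

lemma generated_congruence_superset: "\<sigma> \<subseteq> generated_congruence \<sigma>"
  by (auto simp: generated_congruence_def)

lemma generated_congruence_least:
  "monoid_congruence R \<Longrightarrow> \<sigma> \<subseteq> R \<Longrightarrow> generated_congruence \<sigma> \<subseteq> R"
  by (auto simp: generated_congruence_def)

lemma monoid_congruence_refl: "monoid_congruence R \<Longrightarrow> (u, u) \<in> R"
  by (auto simp: monoid_congruence_def equiv_def refl_on_def)

lemma monoid_congruence_add:
  assumes "monoid_congruence R" "(u, v) \<in> R" "(u', v') \<in> R"
  shows "(u + u', v + v') \<in> R"
proof -
  have "(u + u', v + u') \<in> R" "(u' + v, v' + v) \<in> R"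
    using assms by (auto simp: monoid_congruence_def)
  then show ?thesis
    using assms(1) by (auto simp: monoid_congruence_def equiv_def add.commute elim: transE)
qed

lemma finite_presentation_exists:
  fixes a :: "'p::finite \<Rightarrow> nat ^ 'r"
  obtains \<sigma> where "finite \<sigma>" "presentation a \<sigma>"
proof
  \<comment> \<open>The kernel is closed under differences, so its minimal nonzero pairs generate it even as a monoid.\<close>
  define K where "K = kernel_congruence a"
  define M where "M = {(u, v) \<in> K. (u, v) \<noteq> (0, 0) \<and>
    (\<forall>(u', v') \<in> K. (u', v') \<noteq> (0, 0) \<longrightarrow> (\<forall>i. u' $ i \<le> u $ i) \<longrightarrow> (\<forall>i. v' $ i \<le> v $ i)
        \<longrightarrow> (u', v') = (u, v))}"
  \<comment> \<open>Distinct minimal pairs are incomparable, so Dickson's lemma applies.\<close>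
  show "finite M"
    by (rule finite_antichain_vec_pair) (auto simp: M_def)
  have "(u, v) \<in> generated_congruence M" if "(u, v) \<in> K" for u v
    using that
  proof (induction "len u + len v" arbitrary: u v rule: less_induct)
    case less
    show ?case
    proof (cases "(u, v) = (0, 0) \<or> (u, v) \<in> M")
      case True
      then show ?thesis
        using generated_congruence_superset[of M]
          monoid_congruence_refl[OF monoid_congruence_generated] by auto
    next
      case False
      then obtain u' v' where 1: "(u', v') \<in> K" "(u', v') \<noteq> (0, 0)" "(u', v') \<noteq> (u, v)"
        and le: "\<And>i. u' $ i \<le> u $ i" "\<And>i. v' $ i \<le> v $ i"
        using less.prems by (auto simp: M_def)
      obtain x where x: "u = u' + x" using le(1) by (rule vec_nat_le_ex_add)
      obtain y where y: "v = v' + y" using le(2) by (rule vec_nat_le_ex_add)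
      \<comment> \<open>Cancellation in \<open>nat ^ 'r\<close> keeps the remainder in the kernel.
        Both the smaller pair and the remainder are nonzero, so each has smaller total length than
        \<open>(u, v)\<close>.\<close>
      have xy: "(x, y) \<in> K"
        using less.prems 1(1) x y by (auto simp: K_def kernel_congruence_def fact_hom_add)
      have "x \<noteq> 0 \<or> y \<noteq> 0" using 1(3) x y by auto
      then have "len u' + len v' < len u + len v"
        unfolding x y len_add using len_eq_0[of x] len_eq_0[of y] by linarith
      moreover have "u' \<noteq> 0 \<or> v' \<noteq> 0" using 1(2) by auto
      then have "len x + len y < len u + len v"
        unfolding x y len_add
        using len_eq_0[of u'] len_eq_0[of v'] by linarith
      ultimately have "(u', v') \<in> generated_congruence M" "(x, y) \<in> generated_congruence M"
        using less.hyps 1(1) xy by blast+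
      then show ?thesis
        unfolding x y by (rule monoid_congruence_add[OF monoid_congruence_generated])
    qed
  qed
  then have "K \<subseteq> generated_congruence M" by auto
  moreover have "generated_congruence M \<subseteq> K"
    unfolding K_def by (rule generated_congruence_least[OF monoid_congruence_kernel])
      (auto simp: M_def K_def)
  ultimately show "presentation a M"
    by (auto simp: presentation_def K_def)
qed

text \<open>\<open>Betti\<close> selects a presentation by \<open>SOME\<close>, which is informative
  only once a minimal one exists. Redundant pairs are discarded from a finite presentation until
  none is left.\<close>

lemma minimal_presentation_exists:
  fixes a :: "'p::finite \<Rightarrow> nat ^ 'r"
  shows "\<exists>\<sigma>. minimal_presentation a \<sigma>"
proof -
  have "\<exists>\<tau>. minimal_presentation a \<tau>" if "finite \<sigma>" "presentation a \<sigma>" for \<sigma>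
    using that
  proof (induction \<sigma> rule: finite_psubset_induct)
    case (psubset \<sigma>)
    then show ?case
      unfolding minimal_presentation_def by (cases "\<exists>\<tau>\<subset>\<sigma>. presentation a \<tau>") blast+
  qed
  then show ?thesis
    using finite_presentation_exists by metis
qed

text \<open>A diagonal pair lies in every congruence, so it could be removed. This later yields two
  distinct factorizations of the Betti element.\<close>

lemma minimal_presentation_irrefl:
  assumes "minimal_presentation a \<sigma>" "(u, v) \<in> \<sigma>"
  shows "u \<noteq> v"
proof
  assume "u = v"
  have "monoid_congruence R \<and> \<sigma> - {(u, v)} \<subseteq> R \<longleftrightarrow> monoid_congruence R \<and> \<sigma> \<subseteq> R" for R
    using \<open>u = v\<close> monoid_congruence_refl[of R u] by auto
  then have "generated_congruence (\<sigma> - {(u, v)}) = generated_congruence \<sigma>"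
    by (simp add: generated_congruence_def)
  moreover have "\<sigma> - {(u, v)} \<subset> \<sigma>"
    using assms(2) by blast
  ultimately show False
    using assms(1) unfolding minimal_presentation_def presentation_def by metis
qed

section \<open>A unique Betti element\<close>

text \<open>The elementary moves of the congruence generated by all pairs of factorizations of
  \<open>d\<close>; that congruence is the reflexive transitive closure of
  \<open>swaps a d\<close>.\<close>

definition swaps :: "('p::finite \<Rightarrow> nat ^ 'r) \<Rightarrow> nat ^ 'r \<Rightarrow> (nat ^ 'p) rel" where
  "swaps a d = {(w + z, w + z') | w z z'. fact_hom a z = d \<and> fact_hom a z' = d}"

text \<open>A swap can be undone, and a vector added to both sides is absorbed into the unchanged
  part.\<close>

lemma monoid_congruence_rtrancl_swaps: "monoid_congruence ((swaps a d)\<^sup>*)"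
proof -
  have "sym ((swaps a d)\<^sup>*)"
    by (rule sym_rtrancl) (auto simp: swaps_def sym_def)
  moreover have "(u + w, v + w) \<in> (swaps a d)\<^sup>*" if "(u, v) \<in> (swaps a d)\<^sup>*" for u v w
    using that
  proof induction
    case base
    show ?case by simp
  next
    case (step y z)
    then obtain w' x x' where x: "y = w' + x" "z = w' + x'" "fact_hom a x = d" "fact_hom a x' = d"
      unfolding swaps_def by blast
    have "y + w = (w' + w) + x" "z + w = (w' + w) + x'"
      using x by (simp_all add: algebra_simps)
    then have "(y + w, z + w) \<in> swaps a d"
      unfolding swaps_def using x by blast
    then show ?case using step.IH by simp
  qed
  ultimately show ?thesis
    by (auto simp: monoid_congruence_def equiv_def refl_rtrancl trans_rtrancl)
qed

text \<open>The three facts through which the hypothesis on the Betti elements acts, free of any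
  choice of presentation.\<close>

locale unique_betti =
  fixes a :: "'p::finite \<Rightarrow> nat ^ 'r" and d :: "nat ^ 'r"
  assumes nonzero: "a i \<noteq> 0"
    and connected: "fact_hom a u = fact_hom a v \<Longrightarrow> (u, v) \<in> (swaps a d)\<^sup>*"
    and two: "\<exists>u v. fact_hom a u = d \<and> fact_hom a v = d \<and> u \<noteq> v"

lemma unique_betti_intro:
  assumes nz: "\<And>i. a i \<noteq> 0" and betti: "Betti a = {d}"
  shows "unique_betti a d"
proof
  define \<sigma> where "\<sigma> = (SOME \<sigma>. minimal_presentation a \<sigma>)"
  have min: "minimal_presentation a \<sigma>"
    unfolding \<sigma>_def by (rule someI_ex[OF minimal_presentation_exists])
  then have pres: "generated_congruence \<sigma> = kernel_congruence a"
    by (simp add: minimal_presentation_def presentation_def)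
  have d: "{fact_hom a u | u v. (u, v) \<in> \<sigma>} = {d}"
    using betti by (simp add: Betti_def Let_def \<sigma>_def)
  \<comment> \<open>\<open>Betti\<close> records first components; the second has the same image
    because \<sigma> lies in the kernel congruence.\<close>
  have fd: "fact_hom a u = d \<and> fact_hom a v = d" if "(u, v) \<in> \<sigma>" for u v
  proof -
    have "(u, v) \<in> kernel_congruence a"
      using that pres generated_congruence_superset by blast
    moreover have "fact_hom a u = d" using that d by blast
    ultimately show ?thesis by (simp add: kernel_congruence_def)
  qed
  show "a i \<noteq> 0" for i by (rule nz)
  have "\<sigma> \<subseteq> swaps a d"
  proof safe
    fix u v assume "(u, v) \<in> \<sigma>"
    then have "u = 0 + u \<and> v = 0 + v \<and> fact_hom a u = d \<and> fact_hom a v = d"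
      using fd by simp
    then show "(u, v) \<in> swaps a d" unfolding swaps_def by blast
  qed
  then have "kernel_congruence a \<subseteq> (swaps a d)\<^sup>*"
    unfolding pres[symmetric]
    by (intro generated_congruence_least monoid_congruence_rtrancl_swaps) auto
  then show "(u, v) \<in> (swaps a d)\<^sup>*" if "fact_hom a u = fact_hom a v" for u v
    using that by (auto simp: kernel_congruence_def)
  obtain u v where "(u, v) \<in> \<sigma>" using d by blast
  then show "\<exists>u v. fact_hom a u = d \<and> fact_hom a v = d \<and> u \<noteq> v"
    using fd minimal_presentation_irrefl[OF min] by blast
qed

text \<open>A summand is kept only if it covers at least one unit of \<open>z\<close> that the
  summands chosen so far leave open, so at most \<open>len z\<close> are kept.\<close>

lemma sub_sum_le_card_len:
  fixes u :: "'i \<Rightarrow> nat ^ 'p::finite" and z :: "nat ^ 'p"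
  assumes "finite I" "\<And>i. z $ i \<le> (\<Sum>k\<in>I. u k) $ i"
  shows "\<exists>\<Omega>\<subseteq>I. card \<Omega> \<le> len z \<and> (\<forall>i. z $ i \<le> (\<Sum>k\<in>\<Omega>. u k) $ i)"
  using assms
proof (induction I arbitrary: z rule: finite_induct)
  case empty
  then show ?case by auto
next
  case (insert k I)
  \<comment> \<open>Truncation is intended: \<open>y\<close> is the part of \<open>z\<close> not
    covered by \<open>u k\<close>.\<close>
  define y where "y = z - u k"
  have "y $ i \<le> (\<Sum>k\<in>I. u k) $ i" for i
    using insert.prems[of i] insert.hyps by (simp add: y_def)
  then obtain \<Omega> where \<Omega>: "\<Omega> \<subseteq> I" "card \<Omega> \<le> len y" "\<And>i. y $ i \<le> (\<Sum>k\<in>\<Omega>. u k) $ i"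
    using insert.IH by blast
  show ?case
  proof (cases "y = z")
    case True
    then show ?thesis using \<Omega> by blast
  next
    case False
    have le: "y $ i \<le> z $ i" for i by (simp add: y_def)
    obtain x where x: "z = y + x" using le by (rule vec_nat_le_ex_add)
    have "len y < len z"
    proof -
      have "x \<noteq> 0" using False x by simp
      then show ?thesis unfolding x len_add using len_eq_0[of x] by linarith
    qed
    have fin: "finite \<Omega>" "k \<notin> \<Omega>"
      using \<Omega>(1) insert.hyps finite_subset by blast+
    have "card (insert k \<Omega>) \<le> len z"
      using fin \<Omega>(2) \<open>len y < len z\<close> by simp
    moreover have "z $ i \<le> (\<Sum>k\<in>insert k \<Omega>. u k) $ i" for i
      using \<Omega>(3)[of i] fin by (simp add: y_def)
    moreover have "insert k \<Omega> \<subseteq> insert k I" using \<Omega>(1) by blast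
    ultimately show ?thesis by blast
  qed
qed

context unique_betti
begin

lemma fact_hom_eq_0: "fact_hom a u = 0 \<Longrightarrow> u = 0"
proof (rule ccontr)
  assume 0: "fact_hom a u = 0" and "u \<noteq> 0"
  then obtain i where "u $ i \<noteq> 0" by (auto simp: vec_eq_iff)
  then obtain w where "u = axis i 1 + w" by (rule vec_nat_split_axis)
  then have "a i + fact_hom a w = 0" using 0 by (simp add: fact_hom_add)
  then have "a i = 0" by (auto simp: vec_eq_iff)
  then show False using nonzero by blast
qed

lemma d_nonzero: "d \<noteq> 0"
proof
  assume "d = 0"
  then have "u = 0" if "fact_hom a u = d" for u
    using that fact_hom_eq_0 by simp
  then show False using two by auto
qed

text \<open>Since \<open>u\<close> and \<open>v\<close> differ, the chain of swaps joining them is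
  nonempty, and its first swap removes a factorization of \<open>d\<close> from
  \<open>u\<close>.\<close>

lemma ex_factorization_below:
  assumes "fact_hom a u = fact_hom a v" "u \<noteq> v"
  obtains w z where "u = w + z" "fact_hom a z = d"
  using connected[OF assms(1)]
proof (cases rule: converse_rtranclE)
  case base
  then show thesis using assms by simp
next
  case (step y)
  then show thesis using that by (auto simp: swaps_def)
qed

section \<open>Factorizations of the Betti element\<close>

lemma factorizations_disjoint:
  assumes "fact_hom a z = d" "fact_hom a z' = d" "z \<noteq> z'"
  shows "z $ i = 0 \<or> z' $ i = 0"
proof (rule ccontr)
  assume "\<not> ?thesis"
  then obtain y y' where y: "z = axis i 1 + y" "z' = axis i 1 + y'"
    using vec_nat_split_axis by metis
  then have "fact_hom a y = fact_hom a y'" "y \<noteq> y'"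
    using assms by (auto simp: fact_hom_add)
  \<comment> \<open>\<open>y\<close> factors \<open>d\<close> with one copy of \<open>a i\<close>
    removed, yet a factorization of \<open>d\<close> lies below it.\<close>
  then obtain w x where "y = w + x" "fact_hom a x = d"
    by (rule ex_factorization_below)
  then have "d = (a i + fact_hom a w) + d"
    using assms(1) y by (simp add: fact_hom_add add.assoc)
  then have "a i = 0" by (auto simp: vec_eq_iff)
  then show False using nonzero by blast
qed

lemma fdist_factorizations:
  assumes "fact_hom a z = d" "fact_hom a z' = d" "z \<noteq> z'"
  shows "fdist z z' = max (len z) (len z')"
  by (rule fdist_disjoint) (rule factorizations_disjoint[OF assms])

text \<open>At a swap where coordinate \<open>i\<close> becomes nonzero, the unchanged part vanishes
  at \<open>i\<close>, so the inserted factorization of \<open>d\<close> must involve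
  \<open>i\<close>.\<close>

lemma rtrancl_swaps_gain:
  assumes "(u, v) \<in> (swaps a d)\<^sup>*" "u $ i = 0" "v $ i \<noteq> 0"
  shows "\<exists>z. fact_hom a z = d \<and> z $ i \<noteq> 0"
  using assms
proof induction
  case base
  then show ?case by simp
next
  case (step y z)
  then show ?case
    by (cases "y $ i = 0") (auto simp: swaps_def)
qed

text \<open>\<open>z\<close> comes from the start of the chain and \<open>z'\<close> possibly from a
  much later swap; as both factor \<open>d\<close>, exchanging them is again a single swap.\<close>

lemma swap_gain:
  assumes "fact_hom a u = fact_hom a v" "u $ i = 0" "v $ i \<noteq> 0"
  obtains w z z' where "u = w + z" "fact_hom a z = d" "fact_hom a z' = d" "z' $ i \<noteq> 0"
proof -
  have "u \<noteq> v" using assms by auto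
  with assms(1) obtain w z where "u = w + z" "fact_hom a z = d"
    by (rule ex_factorization_below)
  moreover obtain z' where "fact_hom a z' = d" "z' $ i \<noteq> 0"
    using rtrancl_swaps_gain[OF connected[OF assms(1)]] assms by blast
  ultimately show thesis using that by blast
qed

section \<open>The maximal length of a factorization of the Betti element\<close>

abbreviation M :: nat where "M \<equiv> Max (lengths a d)"

text \<open>Two factorizations with equal and disjoint supports both vanish, so \<open>supp\<close>
  is injective on factorizations of \<open>d\<close>, and there are finitely many supports. This
  gives \<open>Max\<close> its meaning.\<close>

lemma finite_lengths: "finite (lengths a d)"
proof -
  have "inj_on supp (factorizations a d)"
  proof (rule inj_onI)
    fix z z' assume z: "z \<in> factorizations a d" "z' \<in> factorizations a d" and eq: "supp z = supp z'"
    show "z = z'"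
    proof (rule ccontr)
      assume "z \<noteq> z'"
      then have "z $ i = 0 \<or> z' $ i = 0" for i
        using z factorizations_disjoint by (auto simp: factorizations_def)
      moreover have "z $ i = 0 \<longleftrightarrow> z' $ i = 0" for i
        using eq unfolding supp_def set_eq_iff by (simp only: mem_Collect_eq) blast
      ultimately have "z $ i = 0 \<and> z' $ i = 0" for i by blast
      then show False using \<open>z \<noteq> z'\<close> by (simp add: vec_eq_iff)
    qed
  qed
  then have "finite (factorizations a d)"
    by (rule inj_on_finite[of _ _ UNIV]) auto
  then show ?thesis by (simp add: lengths_def)
qed

lemma len_le_M: "fact_hom a z = d \<Longrightarrow> len z \<le> M"
  by (rule Max_ge[OF finite_lengths]) (auto simp: lengths_def factorizations_def)

lemma longest_factorization:
  obtains u v where "fact_hom a u = d" "fact_hom a v = d" "u \<noteq> v" "len u = M"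
proof -
  have "lengths a d \<noteq> {}"
    using two by (auto simp: lengths_def factorizations_def)
  then have "M \<in> lengths a d"
    using finite_lengths Max_in by blast
  then obtain u where "fact_hom a u = d" "len u = M"
    by (auto simp: lengths_def factorizations_def)
  then show thesis using two that by metis
qed

lemma M_pos: "M > 0"
proof -
  obtain u v where u: "fact_hom a u = d" "len u = M" by (rule longest_factorization)
  then have "u \<noteq> 0" using d_nonzero by auto
  then show ?thesis using u len_eq_0[of u] by linarith
qed

lemma fdist_swaps_le:
  assumes "(u, v) \<in> swaps a d"
  shows "fdist u v \<le> M"
proof -
  obtain w z z' where z: "u = w + z" "v = w + z'" "fact_hom a z = d" "fact_hom a z' = d"
    using assms by (auto simp: swaps_def)
  have "fdist u v \<le> max (len z) (len z')"
    unfolding z fdist_add_left by (rule fdist_le)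
  then show ?thesis
    using len_le_M z by (metis max.bounded_iff order.trans)
qed

section \<open>Catenary degree\<close>

text \<open>Chains of swaps give the upper bound. Conversely, a chain leaving a longest
  factorization of \<open>d\<close> must jump to one with disjoint support, at cost at least
  \<open>M\<close>.\<close>

lemma catenary_degree_eq: "catenary_degree (range (fact_hom a)) a = M"
  unfolding catenary_degree_def
proof (rule Least_equality, intro ballI)
  fix x u v assume "u \<in> factorizations a x" "v \<in> factorizations a x"
  then have uv: "fact_hom a u = x" "fact_hom a v = x" by (auto simp: factorizations_def)
  then have "(u, v) \<in> (swaps a d)\<^sup>*" using connected by simp
  then obtain k w where w: "w 0 = u" "w k = v" "\<And>i. i < k \<Longrightarrow> (w i, w (Suc i)) \<in> swaps a d"
    by (metis rtrancl_imp_relpow relpow_fun_conv)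
  have "w i \<in> factorizations a x" if "i \<le> k" for i
    using that
  proof (induction i)
    case 0
    then show ?case using w uv by (simp add: factorizations_def)
  next
    case (Suc i)
    then show ?case
      using w(3)[of i] by (auto simp: factorizations_def swaps_def fact_hom_add)
  qed
  moreover have "fdist (w (i - 1)) (w i) \<le> M" if "i \<in> {1..k}" for i
    using that fdist_swaps_le[OF w(3)[of "i - 1"]] by auto
  ultimately show "\<exists>(k::nat) w. w 0 = u \<and> w k = v \<and> (\<forall>i\<le>k. w i \<in> factorizations a x) \<and>
         (\<forall>i\<in>{1..k}. fdist (w (i - 1)) (w i) \<le> M)"
    using w by blast
next
  fix N
  assume N: "\<forall>x\<in>range (fact_hom a). \<forall>u\<in>factorizations a x. \<forall>v\<in>factorizations a x.
       \<exists>(k::nat) w. w 0 = u \<and> w k = v \<and> (\<forall>i\<le>k. w i \<in> factorizations a x) \<and>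
         (\<forall>i\<in>{1..k}. fdist (w (i - 1)) (w i) \<le> N)"
  obtain u v where uv: "fact_hom a u = d" "fact_hom a v = d" "u \<noteq> v" "len u = M"
    by (rule longest_factorization)
  then have "d \<in> range (fact_hom a)" "u \<in> factorizations a d" "v \<in> factorizations a d"
    by (auto simp: factorizations_def)
  from bspec[OF bspec[OF bspec[OF N this(1)] this(2)] this(3)]
  obtain k :: nat and w where w: "w 0 = u" "w k = v" "\<forall>i\<le>k. w i \<in> factorizations a d"
    "\<forall>i\<in>{1..k}. fdist (w (i - 1)) (w i) \<le> N"
    by blast
  \<comment> \<open>The chain may linger at \<open>u\<close>; \<open>Suc i\<close> is the first
    index at which it has moved away.\<close>
  obtain i where i: "i < k" "\<forall>j\<le>i. w j = u" "w (Suc i) \<noteq> u"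
    using ex_least_nat_less[of "\<lambda>i. w i \<noteq> u" k] w uv by auto
  have "fdist u (w (Suc i)) = max (len u) (len (w (Suc i)))"
    using i uv w(3) by (intro fdist_factorizations) (auto simp: factorizations_def)
  moreover have "fdist u (w (Suc i)) \<le> N"
    using bspec[OF w(4), of "Suc i"] i by auto
  ultimately show "M \<le> N" using uv by simp
qed

section \<open>Tame degree\<close>

text \<open>Either \<open>i\<close> already occurs in \<open>u\<close> and the distance is 0, or one
  swap introduces it. For the lower bound, a longest factorization of \<open>d\<close> must acquire
  a generator from another one, hence be replaced entirely.\<close>

lemma tame_degree_eq: "tame_degree (range (fact_hom a)) a = enat M"
  unfolding tame_degree_def diff_mem_iff
proof (rule Least_equality, intro ballI allI impI)
  fix x u i
  assume "u \<in> factorizations a x" "\<exists>v. fact_hom a v = x \<and> v $ i \<noteq> 0"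
  then obtain v where uv: "fact_hom a u = x" "fact_hom a v = x" "v $ i \<noteq> 0"
    by (auto simp: factorizations_def)
  show "\<exists>u'\<in>factorizations a x. i \<in> supp u' \<and> enat (fdist u u') \<le> enat M"
  proof (cases "u $ i = 0")
    case True
    then obtain w z z' where z: "u = w + z" "fact_hom a z = d" "fact_hom a z' = d" "z' $ i \<noteq> 0"
      using swap_gain[of u v i] uv by auto
    then have "(u, w + z') \<in> swaps a d" by (auto simp: swaps_def)
    then have "enat (fdist u (w + z')) \<le> enat M" using fdist_swaps_le by simp
    moreover have "w + z' \<in> factorizations a x" "i \<in> supp (w + z')"
      using z uv by (auto simp: factorizations_def fact_hom_add supp_def)
    ultimately show ?thesis by blast
  next
    case False
    then show ?thesis
      using uv by (intro bexI[of _ u]) (auto simp: factorizations_def supp_def)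
  qed
next
  fix N
  assume N: "\<forall>x\<in>range (fact_hom a). \<forall>u\<in>factorizations a x. \<forall>i.
       (\<exists>v. fact_hom a v = x \<and> v $ i \<noteq> 0) \<longrightarrow>
       (\<exists>u'\<in>factorizations a x. i \<in> supp u' \<and> enat (fdist u u') \<le> N)"
  obtain u v where uv: "fact_hom a u = d" "fact_hom a v = d" "u \<noteq> v" "len u = M"
    by (rule longest_factorization)
  have "v \<noteq> 0" using uv d_nonzero by auto
  then obtain i where i: "v $ i \<noteq> 0" by (auto simp: vec_eq_iff)
  have "d \<in> range (fact_hom a)" "u \<in> factorizations a d"
    using uv by (auto simp: factorizations_def)
  then obtain u' where u': "fact_hom a u' = d" "u' $ i \<noteq> 0" "enat (fdist u u') \<le> N"
    using N i uv unfolding factorizations_def supp_def by blast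
  have "u $ i = 0" using factorizations_disjoint[of u v i] uv i by blast
  then have "fdist u u' = max (len u) (len u')"
    using u' uv by (intro fdist_factorizations) auto
  then have "enat M \<le> enat (fdist u u')" using uv by simp
  then show "enat M \<le> N" using u'(3) by (rule order.trans)
qed

section \<open>Omega-primality\<close>

text \<open>Upper bound: at most \<open>M\<close> summands cover the factorization of
  \<open>d\<close> that a swap replaces by one involving \<open>j\<close>. Lower bound: the summands
  are the generators in a longest factorization of \<open>d\<close>, with multiplicity, and none can
  be spared.\<close>

lemma omega_primality_eq: "omega_primality (range (fact_hom a)) a = enat M"
  unfolding omega_primality_def diff_mem_iff
proof (rule Least_equality, intro allI impI)
  fix j and I :: "nat set" and b
  assume fin: "finite I" and b: "\<forall>i\<in>I. b i \<in> range (fact_hom a)"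
    and "\<exists>v. fact_hom a v = (\<Sum>i\<in>I. b i) \<and> v $ j \<noteq> 0"
  then obtain v where v: "fact_hom a v = (\<Sum>i\<in>I. b i)" "v $ j \<noteq> 0" by blast
  have "\<forall>i\<in>I. \<exists>y. b i = fact_hom a y" using b by auto
  then obtain u where u: "\<And>i. i \<in> I \<Longrightarrow> b i = fact_hom a (u i)"
    using bchoice by metis
  have sum_b: "fact_hom a (\<Sum>i\<in>\<Omega>. u i) = (\<Sum>i\<in>\<Omega>. b i)" if "\<Omega> \<subseteq> I" for \<Omega>
    using that u by (auto simp: fact_hom_sum intro!: sum.cong)
  show "\<exists>\<Omega>\<subseteq>I. enat (card \<Omega>) \<le> enat M \<and> (\<exists>v. fact_hom a v = (\<Sum>i\<in>\<Omega>. b i) \<and> v $ j \<noteq> 0)"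
  proof (cases "(\<Sum>i\<in>I. u i) $ j = 0")
    case True
    then obtain w z z' where z: "(\<Sum>i\<in>I. u i) = w + z" "fact_hom a z = d" "fact_hom a z' = d"
      "z' $ j \<noteq> 0"
      using swap_gain[of "\<Sum>i\<in>I. u i" v j] v sum_b[of I] by auto
    have "z $ i \<le> (\<Sum>k\<in>I. u k) $ i" for i by (simp only: z(1)) simp
    then obtain \<Omega> where \<Omega>: "\<Omega> \<subseteq> I" "card \<Omega> \<le> len z" and le: "\<And>i. z $ i \<le> (\<Sum>k\<in>\<Omega>. u k) $ i"
      using sub_sum_le_card_len[OF fin, of z u] by blast
    obtain y where y: "(\<Sum>k\<in>\<Omega>. u k) = z + y" using le by (rule vec_nat_le_ex_add)
    have "fact_hom a (z' + y) = (\<Sum>i\<in>\<Omega>. b i)"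
      using sum_b[OF \<Omega>(1)] y z by (simp add: fact_hom_add)
    moreover have "(z' + y) $ j \<noteq> 0" using z by simp
    moreover have "enat (card \<Omega>) \<le> enat M" using \<Omega>(2) len_le_M[OF z(2)] by simp
    ultimately show ?thesis using \<Omega>(1) by blast
  next
    case False
    \<comment> \<open>One summand already involves \<open>j\<close>; positivity of \<open>M\<close>
      leaves room for it.\<close>
    then obtain i where i: "i \<in> I" "u i $ j \<noteq> 0"
      by (metis sum_component sum.neutral)
    then show ?thesis
      using u M_pos by (intro exI[of _ "{i}"]) auto
  qed
next
  fix N
  assume N: "\<forall>j. \<forall>(I :: nat set) b. finite I \<longrightarrow> (\<forall>i\<in>I. b i \<in> range (fact_hom a)) \<longrightarrow>
       (\<exists>v. fact_hom a v = (\<Sum>i\<in>I. b i) \<and> v $ j \<noteq> 0) \<longrightarrow>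
       (\<exists>\<Omega>\<subseteq>I. enat (card \<Omega>) \<le> N \<and> (\<exists>v. fact_hom a v = (\<Sum>i\<in>\<Omega>. b i) \<and> v $ j \<noteq> 0))"
  obtain u v where uv: "fact_hom a u = d" "fact_hom a v = d" "u \<noteq> v" "len u = M"
    by (rule longest_factorization)
  have "v \<noteq> 0" using uv d_nonzero by auto
  then obtain j where j: "v $ j \<noteq> 0" by (auto simp: vec_eq_iff)
  have uj: "u $ j = 0" using factorizations_disjoint[of u v j] uv j by blast
  \<comment> \<open>Listing \<open>u\<close> as a sum of unit vectors makes the index set
    \<open>{..<M}\<close> count generators with multiplicity.\<close>
  have "\<exists>g :: nat \<Rightarrow> 'p. (\<Sum>i<len u. axis (g i) 1) = u" for u :: "nat ^ 'p"
  proof (induction "len u" arbitrary: u)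
    case 0
    then show ?case using len_eq_0[of u] by simp
  next
    case (Suc n)
    then have "u \<noteq> 0" by auto
    then obtain i where "u $ i \<noteq> 0" by (auto simp: vec_eq_iff)
    then obtain w where w: "u = axis i 1 + w" by (rule vec_nat_split_axis)
    have "len (axis i (1::nat) :: nat ^ 'p) = 1" by (simp add: len_def axis_def)
    then have n: "n = len w" using Suc.hyps(2) w by (simp add: len_add)
    then obtain g :: "nat \<Rightarrow> 'p" where g: "(\<Sum>i<n. axis (g i) 1) = w" using Suc.hyps(1) by metis
    have "(\<Sum>k<n. axis ((g(n := i)) k) (1::nat)) = w"
      using g by (metis (no_types, lifting) fun_upd_apply lessThan_iff nat_neq_iff sum.cong)
    then have "(\<Sum>k<Suc n. axis ((g(n := i)) k) (1::nat)) = u"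
      using w by (simp add: add.commute)
    then show ?case using Suc.hyps(2) by metis
  qed
  then obtain g :: "nat \<Rightarrow> 'p" where g: "(\<Sum>i<M. axis (g i) 1) = u" using uv(4) by metis
  have fs: "fact_hom a (\<Sum>i\<in>\<Omega>. axis (g i) 1) = (\<Sum>i\<in>\<Omega>. a (g i))" for \<Omega>
    by (simp add: fact_hom_sum)
  have "(\<Sum>i<M. a (g i)) = d" using fs[of "{..<M}"] g uv by simp
  then have "\<exists>v. fact_hom a v = (\<Sum>i<M. a (g i)) \<and> v $ j \<noteq> 0"
    using uv(2) j by auto
  moreover have "\<forall>i\<in>{..<M}. a (g i) \<in> range (fact_hom a)"
    using fact_hom_axis by (metis rangeI)
  ultimately obtain \<Omega> v' where \<Omega>: "\<Omega> \<subseteq> {..<M}" "enat (card \<Omega>) \<le> N"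
    and v': "fact_hom a v' = (\<Sum>i\<in>\<Omega>. a (g i))" "v' $ j \<noteq> 0"
    using N[rule_format, of "{..<M}" "\<lambda>i. a (g i)" j] by blast
  have "\<Omega> = {..<M}"
  proof (rule ccontr)
    assume "\<Omega> \<noteq> {..<M}"
    then obtain m where m: "m < M" "m \<notin> \<Omega>" using \<Omega>(1) by blast
    define x where "x = (\<Sum>i\<in>\<Omega>. axis (g i) (1::nat))"
    have "u = x + (\<Sum>i\<in>{..<M} - \<Omega>. axis (g i) 1)"
      unfolding x_def g[symmetric] by (subst sum.subset_diff[OF \<Omega>(1)]) (simp_all add: add.commute)
    also have "(\<Sum>i\<in>{..<M} - \<Omega>. axis (g i) (1::nat)) =
        axis (g m) 1 + (\<Sum>i\<in>{..<M} - \<Omega> - {m}. axis (g i) 1)"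
      using m by (intro sum.remove) auto
    finally obtain y where y: "u = x + (axis (g m) 1 + y)" by blast
    \<comment> \<open>The partial sum \<open>x\<close> lies below \<open>u\<close> and so avoids
      \<open>j\<close>, unlike \<open>v'\<close>. Being two factorizations of one element, they
      force a factorization of \<open>d\<close> below \<open>x\<close>, although \<open>x\<close>
      lacks the generator \<open>a (g m)\<close>.\<close>
    have "x $ j = 0" using uj y by simp
    then have "x \<noteq> v'" using v' by auto
    moreover have "fact_hom a x = fact_hom a v'" using fs v' by (simp add: x_def)
    ultimately obtain w z where wz: "x = w + z" "fact_hom a z = d"
      using ex_factorization_below[of x v'] by blast
    then have "d = d + (fact_hom a w + a (g m) + fact_hom a y)"
      using uv(1) y by (simp add: fact_hom_add algebra_simps)
    then have "a (g m) = 0" by (auto simp: vec_eq_iff)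
    then show False using nonzero by blast
  qed
  then show "enat M \<le> N" using \<Omega>(2) by simp
qed

end

theorem theorem19:
  fixes S :: "(nat ^ 'r::finite) set"
    and a :: "'p::finite \<Rightarrow> nat ^ 'r"
    and d :: "nat ^ 'r"
  assumes "affine_semigroup S"
    and "inj a"
    and "minimally_generated_by S (range a)"
    and "Betti a = {d}"
  shows "enat (catenary_degree S a) = omega_primality S a
       \<and> omega_primality S a = tame_degree S a
       \<and> tame_degree S a = enat (Max (lengths a d))"
proof -
  have S: "S = range (fact_hom a)"
    using assms(2,3) by (simp add: minimally_generated_by_def nat_span_range)
  \<comment> \<open>Minimal generation enters here by excluding zero generators.\<close>
  interpret unique_betti a d
    using minimal_generator_nonzero[OF assms(3)] assms(4) by (intro unique_betti_intro) auto
  show ?thesis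
    unfolding S by (simp add: catenary_degree_eq omega_primality_eq tame_degree_eq)
qed

end
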